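(* Let $U=\{u_1,\dots,u_m\}$ be a set of Boolean variables and $C=\{c_1,\dots,c_n\}$ a collection of $3$-literal clauses over $U$ (an instance of X3SAT). Let $w\in\mathbb{R}^{6mn}$ be the objective vector associated with this instance as follows: if clause $c_j$ has the literal $u_i$ at place $k$, then $w^{k,1}_{i,j}=w^{s,2}_{i,j}=1$ for all $s\in\{1,2,3\}\setminus\{k\}$; if clause $c_j$ has the literal $\overline{u}_i$ at place $k$, then $w^{k,2}_{i,j}=w^{s,1}_{i,j}=1$ for all $s\in\{1,2,3\}\setminus\{k\}$; all remaining coordinates of $w$ equal $0$. Let $f_w(x)=\langle w,x\rangle$. Then there exists a truth assignment for the X3SAT problem with exactly one true literal per clause if and only if $$\max_{x\in SATP_{LP}(m,n)} f_w(x)=\max_{z\in SATP(m,n)} f_w(z)=3n.$$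
   Context: For positive integers $m,n$, points of $\mathbb{R}^{6mn}$ have coordinates $x^{k,l}_{i,j}$ with $k\in\{1,2,3\}$, $l\in\{1,2\}$, $i\in\{1,\dots,m\}$, $j\in\{1,\dots,n\}$. $SATP_{LP}(m,n)\subset\mathbb{R}^{6mn}$ is the polytope of all solutions of the system $$\sum_{k,l}x^{k,l}_{i,j}=1,\qquad x^{1,1}_{i,j}+x^{2,1}_{i,j}+x^{3,1}_{i,j}=x^{1,1}_{i,t}+x^{2,1}_{i,t}+x^{3,1}_{i,t},\qquad x^{k,1}_{i,j}+x^{k,2}_{i,j}=x^{k,1}_{s,j}+x^{k,2}_{s,j},\qquad x^{k,l}_{i,j}\ge 0,$$ for all $k\in\{1,2,3\}$, $l\in\{1,2\}$, $i,s\in\{1,\dots,m\}$, $j,t\in\{1,\dots,n\}$, and $SATP(m,n)$ is the convex hull of all integral solutions of this system. A 3-literal clause over $U$ has three literals occupying places $1,2,3$, each being a variable $u_i$ or its negation $\overline{u}_i$. The X3SAT problem (one-in-three, or exactly-1, 3-satisfiability) asks, given $U$ and $C$, whether there exists a truth assignment to the variables so that each clause has exactly one true literal.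
   Formalization: The three literals of each clause are assumed to have pairwise different variables; otherwise the claim fails, e.g. for the single clause (u1,u1,u2) with m=2, n=1, which is satisfiable with exactly one true literal although f_w ≤ 2 < 3. *)

theory Defs
  imports "HOL-Analysis.Analysis"
begin

text \<open>
  Points of \<open>\<real>\<^sup>6\<^sup>m\<^sup>n\<close> with coordinates \<open>x\<^sup>k\<^sup>,\<^sup>l\<^sub>i\<^sub>,\<^sub>j\<close> are vectors \<open>x\<close> indexed by
  \<open>(i, j, k, l)\<close>, where \<open>m = CARD('m)\<close> and \<open>n = CARD('n)\<close>.  The places \<open>k\<close> range over
  the three-element numeral type \<open>3\<close>, and \<open>l\<close> over the two-element numeral type \<open>2\<close>.
  Arithmetic there is modular, so the place \<open>3 :: 3\<close> is the element \<open>0\<close>, and likewise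
  \<open>2 :: 2\<close> is \<open>0\<close>; thus \<open>1, 2, 3 :: 3\<close> and \<open>1, 2 :: 2\<close> enumerate these types.
\<close>

type_synonym ('m, 'n) satp_vec = "real ^ ('m \<times> 'n \<times> 3 \<times> 2)"

definition SATP_LP :: "('m::finite, 'n::finite) satp_vec set" where
  "SATP_LP = {x.
     (\<forall>i j. (\<Sum>k\<in>UNIV. \<Sum>l\<in>UNIV. x $ (i, j, k, l)) = 1) \<and>
     (\<forall>i j t. x $ (i, j, 1, 1) + x $ (i, j, 2, 1) + x $ (i, j, 3, 1)
            = x $ (i, t, 1, 1) + x $ (i, t, 2, 1) + x $ (i, t, 3, 1)) \<and>
     (\<forall>i s j k. x $ (i, j, k, 1) + x $ (i, j, k, 2) = x $ (s, j, k, 1) + x $ (s, j, k, 2)) \<and>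
     (\<forall>i j k l. x $ (i, j, k, l) \<ge> 0)}"

definition SATP :: "('m::finite, 'n::finite) satp_vec set" where
  "SATP = convex hull {x \<in> SATP_LP. \<forall>p. x $ p \<in> \<int>}"

datatype 'v literal = Pos (lit_var: 'v) | Neg (lit_var: 'v)

fun lit_true :: "('v \<Rightarrow> bool) \<Rightarrow> 'v literal \<Rightarrow> bool" where
  "lit_true \<tau> (Pos v) = \<tau> v"
| "lit_true \<tau> (Neg v) = (\<not> \<tau> v)"

text \<open>A clause assigns a literal to each of its three places.\<close>

type_synonym 'v clause3 = "3 \<Rightarrow> 'v literal"

text \<open>
  The three places of a clause carry pairwise different variables.  Without this, the
  objective vector below can give a clause at most the value 2, even if it is satisfiable:
  an example is the single clause \<open>(u\<^sub>1, u\<^sub>1, u\<^sub>2)\<close>.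
\<close>

definition distinct_vars :: "'v clause3 \<Rightarrow> bool" where
  "distinct_vars c \<longleftrightarrow> inj (\<lambda>k. lit_var (c k))"

definition x3sat_assignment :: "('n \<Rightarrow> 'm clause3) \<Rightarrow> ('m \<Rightarrow> bool) \<Rightarrow> bool" where
  "x3sat_assignment C \<tau> \<longleftrightarrow> (\<forall>j. \<exists>!k. lit_true \<tau> (C j k))"

definition objective :: "('n::finite \<Rightarrow> 'm::finite clause3) \<Rightarrow> ('m, 'n) satp_vec" where
  "objective C = (\<chi> q. case q of (i, j, k, l) \<Rightarrow>
     if \<exists>p. (C j p = Pos i \<and> (k = p \<and> l = 1 \<or> k \<noteq> p \<and> l = 2)) \<or>
            (C j p = Neg i \<and> (k = p \<and> l = 2 \<or> k \<noteq> p \<and> l = 1))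
     then 1 else 0)"

text \<open>The maximum of \<open>f\<close> on \<open>S\<close> exists (is attained) and equals \<open>v\<close>.\<close>

definition has_max_on :: "('a \<Rightarrow> real) \<Rightarrow> 'a set \<Rightarrow> real \<Rightarrow> bool" where
  "has_max_on f S v \<longleftrightarrow> (\<exists>x\<in>S. f x = v) \<and> (\<forall>x\<in>S. f x \<le> v)"

end

theory Submission imports Defs begin

text \<open>
  An integral solution of the system amounts to a truth assignment \<open>\<tau>\<close> together with a place
  \<open>\<kappa> j\<close> for every clause: the only nonzero entry of the block \<open>(i, j)\<close> is at \<open>k = \<kappa> j\<close>, with
  \<open>l = 1\<close> iff \<open>u\<^sub>i\<close> is true.  The objective is a sum of \<open>3 n\<close> gains, one for each
  literal occurrence, and each gain is at most \<open>1\<close> on the relaxed polytope.  At the integral point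
  of \<open>\<tau>\<close> and \<open>\<kappa>\<close>, the gain of place \<open>p\<close> of clause \<open>j\<close> is \<open>1\<close> iff the literal there is true
  exactly when \<open>p = \<kappa> j\<close>.  Hence the value \<open>3 n\<close> is attained at an integral point iff some
  assignment satisfies exactly one literal per clause, and a linear functional that attains the
  value on the convex hull of the integral points also attains it at one of them.
\<close>

definition satp_point :: "('n::finite \<Rightarrow> 3) \<Rightarrow> ('m::finite \<Rightarrow> bool) \<Rightarrow> ('m, 'n) satp_vec" where
  "satp_point \<kappa> \<tau> = (\<chi> q. case q of (i, j, k, l) \<Rightarrow> of_bool (k = \<kappa> j \<and> (l = 1) = \<tau> i))"

text \<open>The constant assignment \<open>l = 1\<close> turns the literal at place \<open>p\<close> into the column that makes it true.\<close>

definition gain :: "('n::finite \<Rightarrow> 'm::finite clause3) \<Rightarrow> ('m, 'n) satp_vec \<Rightarrow> 'n \<Rightarrow> 3 \<Rightarrow> real" where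
  "gain C x j p = (\<Sum>k\<in>UNIV. \<Sum>l\<in>UNIV.
     of_bool ((k = p) = lit_true (\<lambda>_. l = 1) (C j p)) * x $ (lit_var (C j p), j, k, l))"

section \<open>Decomposition of the objective into gains\<close>

lemma num2_eq_2_iff: "(l :: 2) = 2 \<longleftrightarrow> l \<noteq> 1"
  using exhaust_2[of l] by auto

text \<open>A literal depends on the value of its own variable only, so the column test
  \<open>l = 1\<close> in \<open>gain\<close> can be compared with a full assignment.\<close>

lemma lit_true_const: "lit_true (\<lambda>_. \<tau> (lit_var L)) L = lit_true \<tau> L"
  by (cases L) auto

text \<open>Distinctness of the variables makes \<open>p\<close> the only place of the clause that
  mentions this variable, so the existential in \<open>objective\<close> has no other possible
  witness.\<close>

lemma objective_at_lit_var:
  assumes "distinct_vars (C j)"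
  shows "objective C $ (lit_var (C j p), j, k, l) =
    of_bool ((k = p) = lit_true (\<lambda>_. l = 1) (C j p))"
proof -
  have inj: "q = p" if "lit_var (C j q) = lit_var (C j p)" for q
    using assms that by (auto simp: distinct_vars_def dest: injD)
  show ?thesis
  proof (cases "C j p")
    case (Pos v)
    then have eq: "C j q = Pos v \<longleftrightarrow> q = p" "C j q \<noteq> Neg v" for q
      using inj[of q] by auto
    then show ?thesis by (simp add: objective_def Pos) (auto simp: eq num2_eq_2_iff)
  next
    case (Neg v)
    then have eq: "C j q = Neg v \<longleftrightarrow> q = p" "C j q \<noteq> Pos v" for q
      using inj[of q] by auto
    then show ?thesis by (simp add: objective_def Neg) (auto simp: eq num2_eq_2_iff)
  qed
qed

lemma objective_not_lit_var:
  assumes "i \<notin> range (\<lambda>p. lit_var (C j p))"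
  shows "objective C $ (i, j, k, l) = 0"
proof -
  have "C j p \<noteq> Pos i" "C j p \<noteq> Neg i" for p
    using assms by (metis literal.sel rangeI)+
  then show ?thesis by (simp add: objective_def)
qed

text \<open>For a fixed clause, only the blocks of its own variables carry weight, and these
  variables correspond injectively to the three places.\<close>

lemma objective_inner_eq_sum_gain:
  fixes C :: "'n::finite \<Rightarrow> 'm::finite clause3"
  assumes "\<And>j. distinct_vars (C j)"
  shows "objective C \<bullet> x = (\<Sum>j\<in>UNIV. \<Sum>p\<in>UNIV. gain C x j p)"
proof -
  define B where "B i j = (\<Sum>k\<in>UNIV. \<Sum>l\<in>UNIV. objective C $ (i, j, k, l) * x $ (i, j, k, l))" for i j
  have "objective C \<bullet> x = (\<Sum>i\<in>UNIV. \<Sum>j\<in>UNIV. B i j)"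
    unfolding inner_vec_def B_def UNIV_Times_UNIV[symmetric] sum.cartesian_product
    by (simp add: case_prod_beta)
  also have "\<dots> = (\<Sum>j\<in>UNIV. \<Sum>i\<in>UNIV. B i j)"
    by (rule sum.swap)
  also have "\<dots> = (\<Sum>j\<in>UNIV. \<Sum>p\<in>UNIV. gain C x j p)"
  proof (rule sum.cong[OF refl])
    fix j
    have inj: "inj (\<lambda>p. lit_var (C j p))"
      using assms by (simp add: distinct_vars_def)
    have "(\<Sum>i\<in>UNIV. B i j) = (\<Sum>i\<in>range (\<lambda>p. lit_var (C j p)). B i j)"
      by (rule sum.mono_neutral_right) (auto simp: B_def objective_not_lit_var)
    also have "\<dots> = (\<Sum>p\<in>UNIV. B (lit_var (C j p)) j)"
      using inj by (simp add: sum.reindex)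
    also have "\<dots> = (\<Sum>p\<in>UNIV. gain C x j p)"
      by (simp only: B_def gain_def objective_at_lit_var[of C, OF assms])
    finally show "(\<Sum>i\<in>UNIV. B i j) = (\<Sum>p\<in>UNIV. gain C x j p)" .
  qed
  finally show ?thesis .
qed

text \<open>The coefficients are 0 or 1 and the entries of \<open>x\<close> are nonnegative, so the
  gain is at most the total mass of one block.\<close>

lemma gain_le_1:
  assumes "x \<in> SATP_LP"
  shows "gain C x j p \<le> 1"
proof -
  have "gain C x j p \<le> (\<Sum>k\<in>UNIV. \<Sum>l\<in>UNIV. x $ (lit_var (C j p), j, k, l))"
    unfolding gain_def using assms by (intro sum_mono) (auto simp: SATP_LP_def)
  also have "\<dots> = 1"
    using assms by (simp add: SATP_LP_def)
  finally show ?thesis .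
qed

lemma objective_inner_le:
  fixes C :: "'n::finite \<Rightarrow> 'm::finite clause3"
  assumes "\<And>j. distinct_vars (C j)" "x \<in> SATP_LP"
  shows "objective C \<bullet> x \<le> 3 * real CARD('n)"
proof -
  have "objective C \<bullet> x \<le> (\<Sum>j\<in>(UNIV::'n set). \<Sum>p\<in>(UNIV::3 set). 1)"
    unfolding objective_inner_eq_sum_gain[of C, OF assms(1)]
    by (intro sum_mono gain_le_1 assms(2))
  then show ?thesis by simp
qed

text \<open>A sum of 3n terms, each at most 1, leaves no slack when it reaches 3n. The lower bound
  \<open>\<ge>\<close> is the form in which the integral point is found later.\<close>

lemma gain_eq_1_if_objective_max:
  fixes C :: "'n::finite \<Rightarrow> 'm::finite clause3"
  assumes "\<And>j. distinct_vars (C j)" "x \<in> SATP_LP" "objective C \<bullet> x \<ge> 3 * real CARD('n)"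
  shows "gain C x j p = 1"
proof (rule ccontr)
  assume "gain C x j p \<noteq> 1"
  with gain_le_1[OF assms(2)] have less: "gain C x j p < 1"
    by (simp add: less_le)
  \<comment> \<open>A deficit at place \<open>p\<close> pushes clause \<open>j\<close> strictly
    below 3, and therefore the whole sum strictly below 3n.\<close>
  have "(\<Sum>p\<in>UNIV. gain C x j p) < (\<Sum>p\<in>(UNIV::3 set). 1)"
    using less by (intro sum_strict_mono_ex1) (auto intro: gain_le_1 assms(2))
  then have "(\<Sum>j\<in>UNIV. \<Sum>p\<in>UNIV. gain C x j p) < (\<Sum>j\<in>(UNIV::'n set). \<Sum>p\<in>(UNIV::3 set). 1)"
    by (intro sum_strict_mono_ex1) (auto intro!: sum_mono gain_le_1 assms(2) simp del: sum_constant)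
  with assms(3) show False
    by (simp add: objective_inner_eq_sum_gain[of C, OF assms(1)])
qed

section \<open>Integral points of the system\<close>

lemma satp_point_in_SATP_LP:
  fixes \<kappa> :: "'n::finite \<Rightarrow> 3" and \<tau> :: "'m::finite \<Rightarrow> bool"
  shows "satp_point \<kappa> \<tau> \<in> SATP_LP"
proof -
  let ?x = "satp_point \<kappa> \<tau>"
  have row: "?x $ (i, j, 1, 1) + ?x $ (i, j, 2, 1) + ?x $ (i, j, 3, 1) = of_bool (\<tau> i)" for i j
    using exhaust_3[of "\<kappa> j"] by (auto simp: satp_point_def)
  have place: "?x $ (i, j, k, 1) + ?x $ (i, j, k, 2) = of_bool (k = \<kappa> j)" for i j k
    by (auto simp: satp_point_def)
  have "(\<Sum>k\<in>UNIV. \<Sum>l\<in>UNIV. ?x $ (i, j, k, l)) = 1" for i j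
    by (simp add: sum_2 place of_bool_def)
  moreover have "?x $ (i, j, k, l) \<ge> 0" for i j k l
    by (simp add: satp_point_def)
  ultimately show ?thesis
    by (simp add: SATP_LP_def row place)
qed

lemma satp_point_Ints: "satp_point \<kappa> \<tau> $ q \<in> \<int>"
  by (cases q) (simp add: satp_point_def)

lemma gain_satp_point:
  "gain C (satp_point \<kappa> \<tau>) j p = of_bool ((p = \<kappa> j) = lit_true \<tau> (C j p))"
proof -
  \<comment> \<open>\<open>?l\<close> is the column of the nonzero entry of the block. With the
    condition on \<open>l\<close> written as \<open>l = ?l\<close>, both sums collapse to a single
    term.\<close>
  let ?i = "lit_var (C j p)" and ?l = "if \<tau> (lit_var (C j p)) then 1 else 2 :: 2"
  have l: "(l = 1) = \<tau> ?i \<longleftrightarrow> l = ?l" for l :: 2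
    using num2_eq_2_iff by auto
  have "gain C (satp_point \<kappa> \<tau>) j p =
    (\<Sum>k\<in>UNIV. \<Sum>l\<in>UNIV. if l = ?l then if k = \<kappa> j then
       of_bool ((k = p) = lit_true (\<lambda>_. l = 1) (C j p)) else 0 else 0)"
    unfolding gain_def satp_point_def
    by (intro sum.cong refl) (auto simp: l)
  also have "\<dots> = of_bool ((\<kappa> j = p) = lit_true (\<lambda>_. ?l = 1) (C j p))"
    by (simp only: sum.delta finite UNIV_I if_True)
  also have "(?l = 1) = \<tau> ?i" by simp
  finally show ?thesis
    by (simp only: lit_true_const eq_commute[of p])
qed

text \<open>Some term is nonzero; being a nonnegative integer, it is at least 1 and so uses up the
  whole sum.\<close>

lemma nonneg_Ints_sum_eq_1E:
  fixes f :: "'a \<Rightarrow> real"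
  assumes "finite A" "\<And>a. a \<in> A \<Longrightarrow> f a \<in> \<int>" "\<And>a. a \<in> A \<Longrightarrow> f a \<ge> 0" "sum f A = 1"
  obtains a where "a \<in> A" "\<And>b. b \<in> A \<Longrightarrow> f b = of_bool (b = a)"
proof -
  obtain a where a: "a \<in> A" "f a \<noteq> 0"
    using assms(4) by (metis sum.neutral zero_neq_one)
  have ge: "f a \<ge> 1"
    using assms(2)[OF a(1)] assms(3)[OF a(1)] a(2) by (auto elim!: Ints_cases)
  have split: "f a + sum f (A - {a}) = 1"
    using assms(1,4) a(1) by (simp add: sum.remove)
  have nonneg: "sum f (A - {a}) \<ge> 0"
    using assms(3) by (auto intro: sum_nonneg)
  have "sum f (A - {a}) = 0" "f a = 1"
    using ge split nonneg by linarith+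
  moreover from this have "\<forall>b\<in>A - {a}. f b = 0"
    using assms(1,3) by (subst (asm) sum_nonneg_eq_0_iff) auto
  ultimately show thesis
    using a(1) by (intro that[of a]) auto
qed

text \<open>Each block is a 0/1 vector with its single 1 at position \<open>a i j\<close>. The
  second family of equations makes the \<open>l\<close> of this position independent of
  \<open>j\<close>, the third makes its \<open>k\<close> independent of \<open>i\<close>.\<close>

lemma integral_SATP_LP_is_satp_point:
  fixes x :: "('m::finite, 'n::finite) satp_vec"
  assumes "x \<in> SATP_LP" "\<forall>q. x $ q \<in> \<int>"
  obtains \<kappa> \<tau> where "x = satp_point \<kappa> \<tau>"
proof -
  have "\<exists>a. \<forall>k l. x $ (i, j, k, l) = of_bool ((k, l) = a)" for i j
  proof -
    have "sum (\<lambda>(k, l). x $ (i, j, k, l)) UNIV = 1"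
      using assms(1) unfolding UNIV_Times_UNIV[symmetric] sum.cartesian_product[symmetric]
      by (simp add: SATP_LP_def)
    then obtain a where "\<And>b. b \<in> UNIV \<Longrightarrow> (\<lambda>(k, l). x $ (i, j, k, l)) b = of_bool (b = a)"
      using assms by (auto simp: SATP_LP_def
          intro: nonneg_Ints_sum_eq_1E[of UNIV "\<lambda>(k, l). x $ (i, j, k, l)"])
    then show ?thesis by (metis UNIV_I case_prod_conv)
  qed
  then obtain a where a: "\<And>i j k l. x $ (i, j, k, l) = of_bool ((k, l) = a i j)"
    by metis
  have col: "(snd (a i j) = 1) = (snd (a i t) = 1)" for i j t
  proof -
    have row: "x $ (i, j, 1, 1) + x $ (i, j, 2, 1) + x $ (i, j, 3, 1) = of_bool (snd (a i j) = 1)"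
      for j
      using exhaust_3[of "fst (a i j)"] by (cases "a i j") (auto simp: a)
    have "x $ (i, j, 1, 1) + x $ (i, j, 2, 1) + x $ (i, j, 3, 1) =
        x $ (i, t, 1, 1) + x $ (i, t, 2, 1) + x $ (i, t, 3, 1)"
      using assms(1) by (simp add: SATP_LP_def)
    then show ?thesis by (simp only: row of_bool_eq_iff)
  qed
  have place: "fst (a i j) = fst (a s j)" for i s j
  proof -
    have clm: "x $ (i, j, k, 1) + x $ (i, j, k, 2) = of_bool (k = fst (a i j))" for i k
      using exhaust_2[of "snd (a i j)"] by (cases "a i j") (auto simp: a)
    have "x $ (i, j, k, 1) + x $ (i, j, k, 2) = x $ (s, j, k, 1) + x $ (s, j, k, 2)" for k
      using assms(1) unfolding SATP_LP_def by blast
    then have "k = fst (a i j) \<longleftrightarrow> k = fst (a s j)" for k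
      by (simp only: clm of_bool_eq_iff)
    then show ?thesis by blast
  qed
  \<comment> \<open>\<open>undefined\<close> serves as an arbitrary fixed index: by
    \<open>place\<close> and \<open>col\<close> the choice does not matter.\<close>
  have "x $ (i, j, k, l) = of_bool (k = fst (a undefined j) \<and> (l = 1) = (snd (a i undefined) = 1))"
    for i j k l
    using place[of i j undefined] col[of i j undefined] exhaust_2[of l] exhaust_2[of "snd (a i j)"]
    by (cases "a i j") (auto simp: a)
  then have "x = satp_point (\<lambda>j. fst (a undefined j)) (\<lambda>i. snd (a i undefined) = 1)"
    by (auto simp: vec_eq_iff satp_point_def)
  then show thesis by (rule that)
qed

section \<open>Convexity and the integral hull\<close>

lemma convex_SATP_LP: "convex SATP_LP"
proof (rule convexI)
  fix x y :: "('m::finite, 'n::finite) satp_vec" and u v :: real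
  assume x: "x \<in> SATP_LP" and y: "y \<in> SATP_LP" and uv: "0 \<le> u" "0 \<le> v" "u + v = 1"
  let ?z = "u *\<^sub>R x + v *\<^sub>R y"
  have "(\<Sum>k\<in>UNIV. \<Sum>l\<in>UNIV. ?z $ (i, j, k, l)) = u * 1 + v * 1" for i j
    using x y unfolding SATP_LP_def
    by (simp add: sum.distrib sum_distrib_left[symmetric])
  moreover have "?z $ (i, j, 1, 1) + ?z $ (i, j, 2, 1) + ?z $ (i, j, 3, 1)
      = ?z $ (i, t, 1, 1) + ?z $ (i, t, 2, 1) + ?z $ (i, t, 3, 1)" for i j t
  proof -
    have eq: "?z $ (i, j, 1, 1) + ?z $ (i, j, 2, 1) + ?z $ (i, j, 3, 1) =
      u * (x $ (i, j, 1, 1) + x $ (i, j, 2, 1) + x $ (i, j, 3, 1)) +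
      v * (y $ (i, j, 1, 1) + y $ (i, j, 2, 1) + y $ (i, j, 3, 1))" for j
      by (simp add: algebra_simps)
    have "x $ (i, j, 1, 1) + x $ (i, j, 2, 1) + x $ (i, j, 3, 1) =
        x $ (i, t, 1, 1) + x $ (i, t, 2, 1) + x $ (i, t, 3, 1)"
      "y $ (i, j, 1, 1) + y $ (i, j, 2, 1) + y $ (i, j, 3, 1) =
        y $ (i, t, 1, 1) + y $ (i, t, 2, 1) + y $ (i, t, 3, 1)"
      using x y by (simp_all add: SATP_LP_def)
    then show ?thesis by (simp only: eq)
  qed
  moreover have "?z $ (i, j, k, 1) + ?z $ (i, j, k, 2) = ?z $ (s, j, k, 1) + ?z $ (s, j, k, 2)"
    for i s j k
  proof -
    have eq: "?z $ (i, j, k, 1) + ?z $ (i, j, k, 2) =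
      u * (x $ (i, j, k, 1) + x $ (i, j, k, 2)) + v * (y $ (i, j, k, 1) + y $ (i, j, k, 2))" for i
      by (simp add: algebra_simps)
    have "x $ (i, j, k, 1) + x $ (i, j, k, 2) = x $ (s, j, k, 1) + x $ (s, j, k, 2)"
      "y $ (i, j, k, 1) + y $ (i, j, k, 2) = y $ (s, j, k, 1) + y $ (s, j, k, 2)"
      using x y unfolding SATP_LP_def by blast+
    then show ?thesis by (simp only: eq)
  qed
  moreover have "?z $ q \<ge> 0" for q
    using x y uv by (cases q) (simp add: SATP_LP_def)
  ultimately show "?z \<in> SATP_LP"
    unfolding SATP_LP_def using uv(3) by simp
qed

text \<open>The hull of points of a convex set stays in that set; thus the upper bound on the
  relaxation carries over to \<open>SATP\<close>.\<close>

lemma SATP_subset_SATP_LP: "SATP \<subseteq> SATP_LP"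
  unfolding SATP_def by (rule hull_minimal) (auto intro: convex_SATP_LP)

lemma satp_point_in_SATP: "satp_point \<kappa> \<tau> \<in> SATP"
  unfolding SATP_def by (rule hull_inc) (simp add: satp_point_in_SATP_LP satp_point_Ints)

theorem theorem12:
  fixes C :: "'n::finite \<Rightarrow> 'm::finite clause3"
  assumes "\<And>j. distinct_vars (C j)"
  shows "(\<exists>\<tau>. x3sat_assignment C \<tau>) \<longleftrightarrow>
    has_max_on (\<lambda>x. objective C \<bullet> x) (SATP_LP :: ('m, 'n) satp_vec set) (3 * real CARD('n)) \<and>
    has_max_on (\<lambda>z. objective C \<bullet> z) (SATP :: ('m, 'n) satp_vec set) (3 * real CARD('n))"
proof (intro iffI)
  assume "\<exists>\<tau>. x3sat_assignment C \<tau>"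
  then obtain \<tau> where \<tau>: "\<And>j. \<exists>!k. lit_true \<tau> (C j k)"
    by (auto simp: x3sat_assignment_def)
  then obtain \<kappa> where "\<And>j k. lit_true \<tau> (C j k) \<longleftrightarrow> k = \<kappa> j"
    by metis
  then have val: "objective C \<bullet> satp_point \<kappa> \<tau> = 3 * real CARD('n)"
    by (simp add: objective_inner_eq_sum_gain[of C, OF assms] gain_satp_point)
  \<comment> \<open>Both maxima are treated at once: the same integral point attains the value, and
    the bound on \<open>SATP_LP\<close> covers every subset \<open>S\<close>.\<close>
  have "has_max_on (\<lambda>x. objective C \<bullet> x) S (3 * real CARD('n))"
    if "satp_point \<kappa> \<tau> \<in> S" "S \<subseteq> SATP_LP" for S
    using that val objective_inner_le[of C, OF assms] unfolding has_max_on_def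
    by (meson subsetD)
  then show "has_max_on (\<lambda>x. objective C \<bullet> x) (SATP_LP :: ('m, 'n) satp_vec set) (3 * real CARD('n)) \<and>
    has_max_on (\<lambda>z. objective C \<bullet> z) (SATP :: ('m, 'n) satp_vec set) (3 * real CARD('n))"
    by (simp add: satp_point_in_SATP_LP satp_point_in_SATP SATP_subset_SATP_LP)
next
  assume "has_max_on (\<lambda>x. objective C \<bullet> x) (SATP_LP :: ('m, 'n) satp_vec set) (3 * real CARD('n)) \<and>
    has_max_on (\<lambda>z. objective C \<bullet> z) (SATP :: ('m, 'n) satp_vec set) (3 * real CARD('n))"
  then obtain z :: "('m, 'n) satp_vec" where z: "z \<in> SATP" "objective C \<bullet> z = 3 * real CARD('n)"
    by (auto simp: has_max_on_def)
  \<comment> \<open>An open half-space is convex: if all integral points lay strictly below 3n, so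
    would their hull, and \<open>z\<close> with it.\<close>
  have "\<exists>x \<in> {x \<in> SATP_LP. \<forall>q. x $ q \<in> \<int>}. objective C \<bullet> x \<ge> 3 * real CARD('n)"
  proof (rule ccontr)
    assume "\<not> ?thesis"
    then have "SATP \<subseteq> {x. objective C \<bullet> x < 3 * real CARD('n)}"
      unfolding SATP_def by (intro hull_minimal convex_halfspace_lt) auto
    with z show False by auto
  qed
  then obtain x where x: "x \<in> SATP_LP" "\<forall>q. x $ q \<in> \<int>" "objective C \<bullet> x \<ge> 3 * real CARD('n)"
    by blast
  obtain \<kappa> \<tau> where "x = satp_point \<kappa> \<tau>"
    using integral_SATP_LP_is_satp_point x(1,2) .
  \<comment> \<open>A gain of 1 at an integral point says exactly that the literal at
    \<open>p\<close> is true iff \<open>p\<close> is the place chosen by \<kappa>.\<close>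
  then have "lit_true \<tau> (C j p) \<longleftrightarrow> p = \<kappa> j" for j p
    using gain_eq_1_if_objective_max[of C, OF assms x(1,3), of j p] by (auto simp: gain_satp_point)
  then have "x3sat_assignment C \<tau>"
    by (simp add: x3sat_assignment_def)
  then show "\<exists>\<tau>. x3sat_assignment C \<tau>" by blast
qed

end
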